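(* Let $\Omega\subseteq\mathbb{R}^n$ be open and suppose $u:\Omega\to\mathbb{R}^N$ is in $C^2(\Omega)^N$, is $\infty$-Harmonic on $\Omega$, and is of full rank. Then, for any nonempty $D\subset\subset\Omega$, $$\sup_D|Du|\le\max_{\partial D}|Du|\qquad\text{and}\qquad \inf_D|Du|\ge\min_{\partial D}|Du|.$$
   Context: Here $n,N\in\mathbb{N}$. $Du(x)\in\mathbb{R}^{N\times n}$ is the gradient matrix with entries $D_iu_\alpha$ and $|Du|$ is its Euclidean (Frobenius) norm. $[Du(x)]^\bot$ is the orthogonal projection of $\mathbb{R}^N$ onto the nullspace of $Du(x)^\top$. The map $u$ is $\infty$-Harmonic on $\Omega$ if it solves $\Delta_\infty u=0$ on $\Omega$, where in components (summing over repeated indices) $$(\Delta_\infty u)_\alpha=D_iu_\alpha\,D_ju_\beta\,D^2_{ij}u_\beta+|Du|^2[Du]^\bot_{\alpha\beta}D^2_{ii}u_\beta,\qquad \alpha=1,\dots,N.$$ The map $u$ is of full rank if $\operatorname{rk}(Du)=\min\{n,N\}$ everywhere on $\Omega$. $D\subset\subset\Omega$ means that $D$ is an open subset whose closure is compact and contained in $\Omega$. *)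

theory Defs
  imports "HOL-Analysis.Analysis"
begin

definition partial :: "'n::finite \<Rightarrow> (real^'n \<Rightarrow> real) \<Rightarrow> real^'n \<Rightarrow> real" where
  "partial i f x = deriv (\<lambda>t. f (x + t *\<^sub>R axis i 1)) 0"

text \<open>The class \<open>C\<^sup>k(S)\<close> of scalar functions, meant for open \<open>S\<close>.
  Differentiability at each level yields continuity of all partial derivatives of order
  below \<open>k\<close>; those of order \<open>k\<close> are required to be continuous.\<close>

primrec Ck_on :: "nat \<Rightarrow> (real^'n::finite) set \<Rightarrow> (real^'n \<Rightarrow> real) \<Rightarrow> bool" where
  "Ck_on 0 S f \<longleftrightarrow> continuous_on S f"
| "Ck_on (Suc k) S f \<longleftrightarrow> f differentiable_on S \<and> (\<forall>i. Ck_on k S (partial i f))"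

definition Ck_map_on :: "nat \<Rightarrow> (real^'n::finite) set \<Rightarrow> (real^'n \<Rightarrow> real^'N::finite) \<Rightarrow> bool" where
  "Ck_map_on k S u \<longleftrightarrow> (\<forall>\<alpha>. Ck_on k S (\<lambda>x. u x $ \<alpha>))"

text \<open>The gradient matrix has \<open>N\<close> rows and \<open>n\<close> columns. The library norm on
  \<^typ>\<open>real^'n^'N\<close> is the Euclidean norm of the vector of Euclidean norms of the rows,
  i.e. the Frobenius norm.\<close>

definition grad :: "(real^'n::finite \<Rightarrow> real^'N::finite) \<Rightarrow> real^'n \<Rightarrow> real^'n^'N" where
  "grad u x = (\<chi> \<alpha> i. partial i (\<lambda>y. u y $ \<alpha>) x)"

definition hess :: "(real^'n::finite \<Rightarrow> real^'N::finite) \<Rightarrow> 'n \<Rightarrow> 'n \<Rightarrow> 'N \<Rightarrow> real^'n \<Rightarrow> real" where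
  "hess u i j \<beta> x = partial i (partial j (\<lambda>y. u y $ \<beta>)) x"

definition orth_proj :: "'a::euclidean_space set \<Rightarrow> 'a \<Rightarrow> 'a" where
  "orth_proj V x = (THE p. p \<in> V \<and> (\<forall>v\<in>V. orthogonal (x - p) v))"

definition perp :: "real^'n::finite^'N::finite \<Rightarrow> real^'N^'N" where
  "perp A = matrix (orth_proj {y. transpose A *v y = 0})"

definition inf_laplacian :: "(real^'n::finite \<Rightarrow> real^'N::finite) \<Rightarrow> real^'n \<Rightarrow> real^'N" where
  "inf_laplacian u x = (\<chi> \<alpha>.
     (\<Sum>i\<in>UNIV. \<Sum>j\<in>UNIV. \<Sum>\<beta>\<in>UNIV.
        grad u x $ \<alpha> $ i * grad u x $ \<beta> $ j * hess u i j \<beta> x)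
     + (norm (grad u x))\<^sup>2 *
       (\<Sum>\<beta>\<in>UNIV. \<Sum>i\<in>UNIV. perp (grad u x) $ \<alpha> $ \<beta> * hess u i i \<beta> x))"

definition inf_harmonic_on :: "(real^'n::finite) set \<Rightarrow> (real^'n \<Rightarrow> real^'N::finite) \<Rightarrow> bool" where
  "inf_harmonic_on \<Omega> u \<longleftrightarrow> (\<forall>x\<in>\<Omega>. inf_laplacian u x = 0)"

definition full_rank_on :: "(real^'n::finite) set \<Rightarrow> (real^'n \<Rightarrow> real^'N::finite) \<Rightarrow> bool" where
  "full_rank_on \<Omega> u \<longleftrightarrow> (\<forall>x\<in>\<Omega>. rank (grad u x) = min CARD('n) CARD('N))"

definition compactly_inside :: "'a::topological_space set \<Rightarrow> 'a set \<Rightarrow> bool" where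
  "compactly_inside D \<Omega> \<longleftrightarrow> open D \<and> compact (closure D) \<and> closure D \<subseteq> \<Omega>"

end

theory Submission
  imports Defs
begin

text \<open>
  The full-rank maximum and minimum principle for \<open>|Du|\<close> rests on one first-order identity.
  The two summands of \<open>\<Delta>\<^sub>\<infinity>u\<close> are mutually orthogonal: the first lies in the range of \<open>Du\<close>, the
  second in the nullspace of its transpose. Hence each vanishes separately, and since
  \<open>D(|Du|\<^sup>2)\<close> has the components \<open>2 D\<^sub>ju\<^sub>\<beta> D\<^sup>2\<^sub>i\<^sub>ju\<^sub>\<beta>\<close>, the first one says that
  \<open>Du D(|Du|\<^sup>2) = 0\<close> (lemma \<open>grad_mult_grad_energy\<close>).

  If \<open>n \<le> N\<close>, the matrix \<open>Du\<close> is injective and \<open>D(|Du|\<^sup>2) = 0\<close>. If \<open>N \<le> n\<close>, its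
  transpose is injective, so every row \<open>Du\<^sub>\<alpha>\<close> is a nonzero vector, and the identity says that
  \<open>|Du|\<^sup>2\<close> has derivative \<open>0\<close> in the direction \<open>Du\<^sub>\<alpha>\<close>, whereas \<open>u\<^sub>\<alpha>\<close> has the
  derivative \<open>|Du\<^sub>\<alpha>|\<^sup>2 > 0\<close>. One could now follow the flow lines of \<open>Du\<^sub>\<alpha>\<close> up to
  the boundary, along which \<open>|Du|\<close> is constant, but a perturbation avoids solving the differential
  equation: for every \<open>\<epsilon> \<noteq> 0\<close> the function \<open>|Du|\<^sup>2 + \<epsilon> u\<^sub>\<alpha>\<close> has no critical point, so
  its extrema over the closure of a bounded open set lie on the boundary, and \<open>\<epsilon>\<close> tends to \<open>0\<close>
  (lemma \<open>maximum_on_frontier_by_perturbation\<close>). In the case \<open>n \<le> N\<close> a coordinate function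
  takes over the part of \<open>u\<^sub>\<alpha>\<close>. The condition is symmetric under a change of sign, which gives the
  minimum principle as well.
\<close>

section \<open>Maxima of functions that are not critical along a second function\<close>

text \<open>
  A direction in which \<open>f\<close> is stationary and \<open>g\<close> is not excludes critical points of
  \<open>f + \<epsilon> g\<close>. The direction may depend on the point in any way, as only its existence is used at
  the one point where \<open>f + \<epsilon> g\<close> is maximal.
\<close>

lemma maximum_on_frontier_by_perturbation:
  fixes f g :: "'a::euclidean_space \<Rightarrow> real"
  assumes "open D" "bounded D" "D \<noteq> {}"
    and contf: "continuous_on (closure D) f" and contg: "continuous_on (closure D) g"
    and deriv: "\<And>x. x \<in> D \<Longrightarrow> \<exists>f' g' v. (f has_derivative f') (at x) \<and>
      (g has_derivative g') (at x) \<and> f' v = 0 \<and> g' v \<noteq> 0"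
  shows "\<exists>y\<in>frontier D. \<forall>x\<in>closure D. f x \<le> f y"
proof -
  have comp: "compact (closure D)" using \<open>bounded D\<close> by simp
  have fr: "frontier D \<noteq> {}"
    using assms(2,3) by (metis frontier_eq_empty not_bounded_UNIV)
  have sub: "frontier D \<subseteq> closure D" by (simp add: frontier_def)
  have "compact (frontier D)" using \<open>bounded D\<close> by (simp add: compact_frontier_bounded)
  then obtain y where y: "y \<in> frontier D" "\<And>z. z \<in> frontier D \<Longrightarrow> f z \<le> f y"
    using continuous_attains_sup[OF _ fr continuous_on_subset[OF contf sub]] by blast
  have "f x \<le> f y" if x: "x \<in> closure D" for x
  proof (rule ccontr)
    assume gap: "\<not> f x \<le> f y"
    have "bounded (g ` closure D)"
      using comp contg compact_continuous_image compact_imp_bounded by blast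
    then obtain B where B: "B > 0" "\<And>z. z \<in> closure D \<Longrightarrow> \<bar>g z\<bar> \<le> B"
      by (auto simp: bounded_pos)
    \<comment> \<open>Small enough that the perturbation cannot close the gap between \<open>f x\<close> and \<open>f y\<close>.\<close>
    define \<epsilon> where "\<epsilon> = (f x - f y) / (4 * B)"
    have eps: "\<epsilon> > 0" "4 * (\<epsilon> * B) = f x - f y" using gap B(1) by (auto simp: \<epsilon>_def)
    have pert: "\<bar>\<epsilon> * g z\<bar> \<le> \<epsilon> * B" if "z \<in> closure D" for z
      using B(2)[OF that] eps(1) by (simp add: abs_mult)
    have "continuous_on (closure D) (\<lambda>z. f z + \<epsilon> * g z)"
      by (intro continuous_intros contf contg)
    then have "\<exists>z\<in>closure D. \<forall>w\<in>closure D. f w + \<epsilon> * g w \<le> f z + \<epsilon> * g z"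
      using x by (intro continuous_attains_sup[OF comp]) auto
    then obtain z where z: "z \<in> closure D"
        "\<And>w. w \<in> closure D \<Longrightarrow> f w + \<epsilon> * g w \<le> f z + \<epsilon> * g z"
      by blast
    have "\<epsilon> * B > 0" using eps(1) B(1) by simp
    then have "f z > f y"
      using pert[OF x] pert[OF z(1)] z(2)[OF x] eps(2) by linarith
    then have "z \<notin> frontier D" using y(2) by force
    then have "z \<in> D"
      using z(1) \<open>open D\<close> by (simp add: frontier_def interior_open)
    then obtain f' g' v where d: "(f has_derivative f') (at z)" "(g has_derivative g') (at z)"
        "f' v = 0" "g' v \<noteq> 0"
      using deriv by blast
    have "((\<lambda>z. f z + \<epsilon> * g z) has_derivative (\<lambda>h. f' h + \<epsilon> * g' h)) (at z)"
      by (intro derivative_intros d)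
    then have "(\<lambda>h. f' h + \<epsilon> * g' h) = (\<lambda>h. 0)"
      using z(2) closure_subset by (intro differential_zero_maxmin[OF \<open>z \<in> D\<close> \<open>open D\<close>]) auto
    then show False using d(3,4) eps(1) by (auto dest: fun_cong[of _ _ v])
  qed
  then show ?thesis using y(1) by blast
qed

section \<open>Partial derivatives and the energy density\<close>

lemma partial_eq_derivative:
  assumes "(f has_derivative f') (at x)"
  shows "partial i f x = f' (axis i 1)"
proof -
  have *: "(f has_derivative f') (at (x + 0 *\<^sub>R axis i 1))" using assms by simp
  have "((\<lambda>t. x + t *\<^sub>R axis i 1) has_derivative (\<lambda>t. t *\<^sub>R axis i 1)) (at (0::real))"
    by (auto intro!: derivative_eq_intros)
  from has_derivative_compose[OF this *]
  have "((\<lambda>t. f (x + t *\<^sub>R axis i 1)) has_derivative (\<lambda>t. f' (t *\<^sub>R axis i 1))) (at 0)" .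
  moreover have "(\<lambda>t. f' (t *\<^sub>R axis i 1)) = (*) (f' (axis i 1))"
    using linear_scale[OF has_derivative_linear[OF assms]] by (auto simp: mult.commute)
  ultimately show ?thesis
    unfolding partial_def has_field_derivative_def[symmetric]
    by (simp add: DERIV_imp_deriv has_field_derivative_def)
qed

lemma has_derivative_partial:
  assumes "f differentiable (at x)"
  shows "(f has_derivative (\<lambda>h. \<Sum>i\<in>UNIV. h $ i * partial i f x)) (at x)"
proof -
  obtain f' where f': "(f has_derivative f') (at x)"
    using assms by (auto simp: differentiable_def)
  have lin: "linear f'" using f' by (rule has_derivative_linear)
  have "f' h = (\<Sum>i\<in>UNIV. h $ i * partial i f x)" for h
  proof -
    have "f' h = f' (\<Sum>i\<in>UNIV. h $ i *\<^sub>R axis i 1)"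
      using basis_expansion[of h] by (simp add: scalar_mult_eq_scaleR)
    also have "\<dots> = (\<Sum>i\<in>UNIV. h $ i * partial i f x)"
      by (simp add: linear_sum[OF lin] linear_scale[OF lin] partial_eq_derivative[OF f'])
    finally show ?thesis .
  qed
  then have "f' = (\<lambda>h. \<Sum>i\<in>UNIV. h $ i * partial i f x)" by blast
  with f' show ?thesis by simp
qed

lemma norm_matrix_power2:
  "(norm (A :: real^'n^'N))\<^sup>2 = (\<Sum>\<beta>\<in>UNIV. \<Sum>j\<in>UNIV. (A $ \<beta> $ j)\<^sup>2)"
  unfolding power2_norm_eq_inner by (simp add: inner_vec_def power2_eq_square)

lemma C2_map_differentiable:
  assumes "open S" "Ck_map_on 2 S u" "x \<in> S"
  shows "(\<lambda>y. u y $ \<alpha>) differentiable (at x)"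
    and "partial i (\<lambda>y. u y $ \<alpha>) differentiable (at x)"
proof -
  have "(\<lambda>y. u y $ \<alpha>) differentiable_on S" "partial i (\<lambda>y. u y $ \<alpha>) differentiable_on S"
    using assms(2) by (simp_all add: Ck_map_on_def numeral_2_eq_2)
  then show "(\<lambda>y. u y $ \<alpha>) differentiable (at x)"
    and "partial i (\<lambda>y. u y $ \<alpha>) differentiable (at x)"
    using assms(1,3) by (simp_all only: differentiable_on_eq_differentiable_at)
qed

text \<open>The gradient of \<open>|Du|\<^sup>2/2\<close>, in the form in which it enters the \<open>\<infinity>\<close>-Laplacian.\<close>

definition half_grad_energy :: "(real^'n::finite \<Rightarrow> real^'N::finite) \<Rightarrow> real^'n \<Rightarrow> real^'n" where
  "half_grad_energy u x = (\<chi> i. \<Sum>j\<in>UNIV. \<Sum>\<beta>\<in>UNIV. grad u x $ \<beta> $ j * hess u i j \<beta> x)"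

lemma has_derivative_energy:
  assumes "open S" "Ck_map_on 2 S u" "x \<in> S"
  shows "((\<lambda>y. (norm (grad u y))\<^sup>2) has_derivative (\<lambda>h. 2 * (half_grad_energy u x \<bullet> h))) (at x)"
proof -
  note d = has_derivative_partial[OF C2_map_differentiable(2)[OF assms]]
  have "((\<lambda>y. \<Sum>\<beta>\<in>UNIV. \<Sum>j\<in>UNIV. (partial j (\<lambda>y. u y $ \<beta>) y)\<^sup>2) has_derivative
     (\<lambda>h. \<Sum>\<beta>\<in>UNIV. \<Sum>j\<in>UNIV. 2 * (partial j (\<lambda>y. u y $ \<beta>) x *
        (\<Sum>i\<in>UNIV. h $ i * hess u i j \<beta> x)))) (at x)"
    unfolding hess_def by (auto intro!: derivative_eq_intros d simp: mult_ac)
  moreover have "(\<Sum>\<beta>\<in>UNIV. \<Sum>j\<in>UNIV. 2 * (partial j (\<lambda>y. u y $ \<beta>) x *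
        (\<Sum>i\<in>UNIV. h $ i * hess u i j \<beta> x))) = 2 * (half_grad_energy u x \<bullet> h)" for h
  proof -
    have "(\<Sum>\<beta>\<in>UNIV. \<Sum>j\<in>UNIV. partial j (\<lambda>y. u y $ \<beta>) x * (\<Sum>i\<in>UNIV. h $ i * hess u i j \<beta> x))
      = (\<Sum>j\<in>UNIV. \<Sum>\<beta>\<in>UNIV. \<Sum>i\<in>UNIV. partial j (\<lambda>y. u y $ \<beta>) x * hess u i j \<beta> x * h $ i)"
      by (subst sum.swap) (simp add: sum_distrib_left mult_ac)
    also have "\<dots> = (\<Sum>j\<in>UNIV. \<Sum>i\<in>UNIV. \<Sum>\<beta>\<in>UNIV. partial j (\<lambda>y. u y $ \<beta>) x * hess u i j \<beta> x * h $ i)"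
      by (intro sum.cong refl sum.swap)
    also have "\<dots> = half_grad_energy u x \<bullet> h"
      by (subst sum.swap) (simp add: half_grad_energy_def inner_vec_def grad_def sum_distrib_right)
    finally show ?thesis by (simp add: sum_distrib_left[symmetric])
  qed
  ultimately show ?thesis by (simp add: norm_matrix_power2 grad_def)
qed

section \<open>Splitting the \<open>\<infinity>\<close>-Laplacian\<close>

lemma orth_proj_mem:
  fixes V :: "'a::euclidean_space set"
  assumes "subspace V"
  shows "orth_proj V x \<in> V"
proof -
  obtain p q where pq: "p \<in> V" "\<And>v. v \<in> V \<Longrightarrow> orthogonal q v" "x = p + q"
    using orthogonal_subspace_decomp_exists[of V x] assms by (auto simp: span_eq_iff[THEN iffD2])
  have "p' = p" if "p' \<in> V" "\<forall>v\<in>V. orthogonal (x - p') v" for p'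
  proof -
    have "p' - p \<in> V" using that(1) pq(1) assms by (simp add: subspace_diff)
    then have "orthogonal (x - p) (p' - p)" "orthogonal (x - p') (p' - p)"
      using that(2) pq(2,3) by auto
    then have "orthogonal (p' - p) (p' - p)"
      by (simp add: orthogonal_def inner_diff_left inner_diff_right)
    then show ?thesis by (simp add: orthogonal_def)
  qed
  then have "orth_proj V x = p"
    unfolding orth_proj_def using pq by (intro the_equality) auto
  with pq(1) show ?thesis by simp
qed

lemma transpose_mult_perp:
  "transpose A ** perp A = 0"
proof -
  have sub: "subspace {y. transpose A *v y = 0}"
    by (intro linear_subspace_kernel matrix_vector_mul_linear)
  have "transpose A *v column \<beta> (perp A) = 0" for \<beta>
  proof -
    have "column \<beta> (perp A) = orth_proj {y. transpose A *v y = 0} (axis \<beta> 1)"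
      by (simp add: vec_eq_iff column_def perp_def matrix_def)
    then show ?thesis using orth_proj_mem[OF sub] by simp
  qed
  then show ?thesis
    by (auto simp: vec_eq_iff matrix_matrix_mult_def matrix_vector_mult_def column_def)
qed

text \<open>
  The first vector is in the range of \<open>A\<close> and the second in the orthogonal complement of that
  range, so a vanishing sum makes both vanish; multiplication by the transpose extracts the first.
\<close>

lemma range_part_eq_0:
  fixes A :: "real^'n^'N"
  assumes "A *v w + c *\<^sub>R (perp A *v z) = 0"
  shows "A *v w = 0"
proof -
  have "transpose A *v (A *v w) = transpose A *v (A *v w + c *\<^sub>R (perp A *v z))"
    by (simp add: matrix_vector_right_distrib matrix_vector_mult_scaleR
        matrix_vector_mul_assoc transpose_mult_perp)
  then have "transpose A *v (A *v w) = 0" using assms by simp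
  then have "(A *v w) \<bullet> (A *v w) = 0"
    by (metis dot_lmul_matrix inner_zero_left transpose_matrix_vector)
  then show ?thesis by simp
qed

lemma grad_mult_grad_energy:
  assumes "inf_laplacian u x = 0"
  shows "grad u x *v half_grad_energy u x = 0"
proof -
  have "inf_laplacian u x = grad u x *v half_grad_energy u x +
      (norm (grad u x))\<^sup>2 *\<^sub>R (perp (grad u x) *v (\<chi> \<beta>. \<Sum>i\<in>UNIV. hess u i i \<beta> x))"
    by (simp add: vec_eq_iff inf_laplacian_def matrix_vector_mult_def half_grad_energy_def
        sum_distrib_left mult.assoc)
  then show ?thesis by (intro range_part_eq_0) (simp add: assms)
qed

section \<open>Full rank and the boundary extrema\<close>

text \<open>
  The perturbing function must be the same for all points of \<open>S\<close>; which one serves depends only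
  on whether the rank condition makes \<open>Du\<close> or its transpose injective.
\<close>

lemma full_rank_perturbing_function:
  fixes u :: "real^'n::finite \<Rightarrow> real^'N::finite"
  assumes "open S" "Ck_map_on 2 S u" "inf_harmonic_on S u" "full_rank_on S u"
  obtains g :: "real^'n \<Rightarrow> real" where "\<And>x. x \<in> S \<Longrightarrow> \<exists>g' v. (g has_derivative g') (at x) \<and>
    half_grad_energy u x \<bullet> v = 0 \<and> g' v \<noteq> 0"
proof (cases "CARD('n) \<le> CARD('N)")
  case True
  obtain i :: 'n where True by simp
  have "\<exists>g' v. ((\<lambda>y. y $ i) has_derivative g') (at x) \<and>
    half_grad_energy u x \<bullet> v = 0 \<and> g' v \<noteq> 0" if "x \<in> S" for x
  proof -
    have "inj ((*v) (grad u x))"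
      using assms(4) that True by (simp add: full_rank_on_def full_rank_injective)
    moreover have "grad u x *v half_grad_energy u x = grad u x *v 0"
      using grad_mult_grad_energy assms(3) that by (auto simp: inf_harmonic_on_def)
    ultimately have "half_grad_energy u x = 0" by (rule injD)
    moreover have "((\<lambda>y. y $ i) has_derivative (\<lambda>h. h $ i)) (at x)"
      by (rule bounded_linear_imp_has_derivative) (rule bounded_linear_vec_nth)
    ultimately show ?thesis
      by (intro exI[of _ "\<lambda>h. h $ i"] exI[of _ "axis i 1"]) simp
  qed
  then show ?thesis by (rule that)
next
  case False
  obtain \<alpha> :: 'N where True by simp
  have "\<exists>g' v. ((\<lambda>y. u y $ \<alpha>) has_derivative g') (at x) \<and>
    half_grad_energy u x \<bullet> v = 0 \<and> g' v \<noteq> 0" if "x \<in> S" for x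
  proof -
    define v where "v = grad u x $ \<alpha>"
    have "rank (transpose (grad u x)) = CARD('N)"
      using assms(4) that False by (simp add: full_rank_on_def rank_transpose)
    then have "inj ((*v) (transpose (grad u x)))" by (simp add: full_rank_injective)
    then have "transpose (grad u x) *v axis \<alpha> 1 \<noteq> transpose (grad u x) *v 0"
      by (simp only: inj_eq) (simp add: axis_eq_0_iff)
    moreover have "transpose (grad u x) *v axis \<alpha> 1 = v"
      by (simp add: matrix_vector_mult_basis v_def column_def transpose_def vec_eq_iff)
    ultimately have "v \<noteq> 0" by simp
    have "(grad u x *v half_grad_energy u x) $ \<alpha> = 0"
      using grad_mult_grad_energy[of u x] assms(3) that by (simp add: inf_harmonic_on_def)
    then have "half_grad_energy u x \<bullet> v = 0"
      by (simp add: matrix_vector_mult_def v_def inner_vec_def mult.commute)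
    moreover have "(\<Sum>i\<in>UNIV. v $ i * partial i (\<lambda>y. u y $ \<alpha>) x) = v \<bullet> v"
      by (simp add: v_def grad_def inner_vec_def)
    ultimately show ?thesis
      using has_derivative_partial[OF C2_map_differentiable(1)[OF assms(1,2) that]] \<open>v \<noteq> 0\<close>
      by (intro exI[of _ "\<lambda>h. \<Sum>i\<in>UNIV. h $ i * partial i (\<lambda>y. u y $ \<alpha>) x"] exI[of _ v]) auto
  qed
  then show ?thesis by (rule that)
qed

theorem proposition2p9:
  fixes \<Omega> D :: "(real^'n::finite) set"
    and u :: "real^'n \<Rightarrow> real^'N::finite"
  assumes "open \<Omega>"
    and "Ck_map_on 2 \<Omega> u"
    and "inf_harmonic_on \<Omega> u"
    and "full_rank_on \<Omega> u"
    and "D \<noteq> {}"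
    and "compactly_inside D \<Omega>"
  shows "bdd_above ((\<lambda>x. norm (grad u x)) ` D) \<and>
         (\<exists>y\<in>frontier D. (\<forall>z\<in>frontier D. norm (grad u z) \<le> norm (grad u y)) \<and>
            (SUP x\<in>D. norm (grad u x)) \<le> norm (grad u y)) \<and>
         (\<exists>y\<in>frontier D. (\<forall>z\<in>frontier D. norm (grad u y) \<le> norm (grad u z)) \<and>
            norm (grad u y) \<le> (INF x\<in>D. norm (grad u x)))"
proof -
  have D: "open D" "bounded D" "closure D \<subseteq> \<Omega>"
    using assms(6) compact_imp_bounded bounded_subset closure_subset
    unfolding compactly_inside_def by blast+
  have cl: "D \<subseteq> closure D" "frontier D \<subseteq> closure D"
    by (auto simp: closure_subset frontier_def)
  obtain g :: "real^'n \<Rightarrow> real" where g: "\<And>x. x \<in> \<Omega> \<Longrightarrow> \<exists>g' v. (g has_derivative g') (at x) \<and>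
    half_grad_energy u x \<bullet> v = 0 \<and> g' v \<noteq> 0"
    using full_rank_perturbing_function[OF assms(1-4)] by blast
  have contg: "continuous_on (closure D) g"
    using g D(3) by (meson continuous_at_imp_continuous_on has_derivative_continuous subsetD)
  \<comment> \<open>The sign \<open>s\<close> lets one argument serve the maximum (\<open>s = 1\<close>) and the minimum (\<open>s = - 1\<close>).\<close>
  have ex: "\<exists>y\<in>frontier D. \<forall>x\<in>closure D. s * (norm (grad u x))\<^sup>2 \<le> s * (norm (grad u y))\<^sup>2" for s :: real
  proof -
    have der: "((\<lambda>y. s * (norm (grad u y))\<^sup>2) has_derivative
        (\<lambda>h. s * (2 * (half_grad_energy u x \<bullet> h)))) (at x)" if "x \<in> \<Omega>" for x
      by (intro derivative_intros has_derivative_energy[OF assms(1,2) that])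
    then have cont: "continuous_on (closure D) (\<lambda>y. s * (norm (grad u y))\<^sup>2)"
      using D(3) by (meson continuous_at_imp_continuous_on has_derivative_continuous subsetD)
    have crit: "\<exists>f' g' v. ((\<lambda>y. s * (norm (grad u y))\<^sup>2) has_derivative f') (at x) \<and>
      (g has_derivative g') (at x) \<and> f' v = 0 \<and> g' v \<noteq> 0" if "x \<in> D" for x
    proof -
      have "x \<in> \<Omega>" using that cl(1) D(3) by blast
      then obtain g' v where "(g has_derivative g') (at x)"
          "half_grad_energy u x \<bullet> v = 0" "g' v \<noteq> 0"
        using g by blast
      then show ?thesis using der[OF \<open>x \<in> \<Omega>\<close>]
        by (intro exI[of _ "\<lambda>h. s * (2 * (half_grad_energy u x \<bullet> h))"] exI[of _ g'] exI[of _ v]) simp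
    qed
    show ?thesis
      by (rule maximum_on_frontier_by_perturbation[OF D(1,2) assms(5) cont contg crit])
  qed
  obtain y where y: "y \<in> frontier D" "\<And>x. x \<in> closure D \<Longrightarrow> norm (grad u x) \<le> norm (grad u y)"
    using ex[of 1] by (auto simp: abs_le_square_iff[symmetric])
  obtain w where w: "w \<in> frontier D" "\<And>x. x \<in> closure D \<Longrightarrow> norm (grad u w) \<le> norm (grad u x)"
    using ex[of "- 1"] by (auto simp: abs_le_square_iff[symmetric])
  have "bdd_above ((\<lambda>x. norm (grad u x)) ` D)"
    using y(2) cl(1) by (intro bdd_aboveI2[of _ _ "norm (grad u y)"]) auto
  moreover have "(SUP x\<in>D. norm (grad u x)) \<le> norm (grad u y)"
    using y(2) cl(1) assms(5) by (intro cSUP_least) auto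
  moreover have "norm (grad u w) \<le> (INF x\<in>D. norm (grad u x))"
    using w(2) cl(1) assms(5) by (intro cINF_greatest) auto
  ultimately show ?thesis using y w cl(2) by blast
qed

end
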